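(* Let $X$ be a set and let $f$ be a bracketed word in $\mathfrak M(X)$. For any two placements $(s_1,q_1)$ and $(s_2,q_2)$ in $f$, exactly one of the following is true: (a) $(s_1,q_1)$ and $(s_2,q_2)$ are separated; (b) $(s_1,q_1)$ and $(s_2,q_2)$ are nested; (c) $(s_1,q_1)$ and $(s_2,q_2)$ are intersecting.
   Context: For a set $Y$, $M(Y)$ is the free monoid on $Y$, with unit (empty word) $1$. For a set $S$, $\lfloor S\rfloor=\{\lfloor s\rfloor\mid s\in S\}$ denotes a set indexed by $S$, disjoint from $S$ (and from the alphabet $Y$). Define $\mathfrak M_0(Y)=M(Y)$ and $\mathfrak M_{n+1}(Y)=M(Y\cup\lfloor\mathfrak M_n(Y)\rfloor)$, with the natural inductively defined embeddings $\mathfrak M_n(Y)\hookrightarrow\mathfrak M_{n+1}(Y)$, and $\mathfrak M(Y)=\bigcup_{n\ge0}\mathfrak M_n(Y)$ (direct limit). Then $\mathfrak M(Y)=M(Y\cup\lfloor\mathfrak M(Y)\rfloor)$ is a monoid with the operator $w\mapsto\lfloor w\rfloor$; its elements are called bracketed words on $Y$ (it is the free monoid-with-a-self-map on $Y$). Let $\star,\star_1,\star_2$ be distinct symbols not in $X$. $\mathfrak M^\star(X)$ is the set of elements of $\mathfrak M(X\cup\{\star\})$ with exactly one occurrence of $\star$; $\mathfrak M^{\star_1,\star_2}(X)$ is the set of elements of $\mathfrak M(X\cup\{\star_1,\star_2\})$ with exactly one occurrence of each of $\star_1,\star_2$. For $q\in\mathfrak M^\star(X)$, $q|_s$ is the bracketed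 word obtained by replacing $\star$ in $q$ by $s$; for $q\in\mathfrak M^{\star_1,\star_2}(X)$, $q|_{s_1,s_2}$ is obtained by replacing $\star_1$ by $s_1$ and $\star_2$ by $s_2$ (the substituted bracketed words may themselves contain star symbols). A placement in $f\in\mathfrak M(X)$ is a pair $(s,q)$ with $s\in\mathfrak M(X)$, $s\ne1$, $q\in\mathfrak M^\star(X)$ and $f=q|_s$. Two placements $(s_1,q_1)$ and $(s_2,q_2)$ in $f$ are called: (i) separated if there exists $q\in\mathfrak M^{\star_1,\star_2}(X)$ with $q_1|_{\star_1}=q|_{\star_1,s_2}$, $q_2|_{\star_2}=q|_{s_1,\star_2}$ and $f=q|_{s_1,s_2}$; (ii) nested if there exists $q\in\mathfrak M^\star(X)$ with $q_1=q_2|_q$ or $q_2=q_1|_q$; (iii) intersecting if there exist $q\in\mathfrak M^\star(X)$ and $a,b,c\in\mathfrak M(X)\setminus\{1\}$ such that either $f=q|_{abc}$, $q_1=q|_{\star c}$, $q_2=q|_{a\star}$, or $f=q|_{abc}$, $q_1=q|_{a\star}$, $q_2=q|_{\star c}$. *)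

theory Defs imports Main begin

text \<open>A word is a list of letters, so the unit is \<open>[]\<close> and the product is \<open>@\<close>.
  The datatype is the ambient type in which the embeddings
  \<open>M\<^sub>n(Y) \<rightarrow> M\<^sub>n\<^sub>+\<^sub>1(Y)\<close> become inclusions.\<close>

datatype 'y letter = Sym 'y | Bracket "'y letter list"

type_synonym 'y bword = "'y letter list"

primrec bracketed_stage :: "nat \<Rightarrow> 'y set \<Rightarrow> 'y bword set" where
  "bracketed_stage 0 Y = lists (Sym ` Y)"
| "bracketed_stage (Suc n) Y = lists (Sym ` Y \<union> Bracket ` bracketed_stage n Y)"

definition bracketed_words :: "'y set \<Rightarrow> 'y bword set" where
  "bracketed_words Y = (\<Union>n. bracketed_stage n Y)"

primrec occ_letter :: "'y \<Rightarrow> 'y letter \<Rightarrow> nat" where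
  "occ_letter y (Sym z) = (if z = y then 1 else 0)"
| "occ_letter y (Bracket w) = sum_list (map (occ_letter y) w)"

definition occ :: "'y \<Rightarrow> 'y bword \<Rightarrow> nat" where
  "occ y w = sum_list (map (occ_letter y) w)"

text \<open>Simultaneous substitution: symbols inside the inserted words are left alone.\<close>

primrec subst_letter :: "('y \<Rightarrow> 'y bword) \<Rightarrow> 'y letter \<Rightarrow> 'y bword" where
  "subst_letter \<sigma> (Sym y) = \<sigma> y"
| "subst_letter \<sigma> (Bracket w) = [Bracket (concat (map (subst_letter \<sigma>) w))]"

definition subst :: "('y \<Rightarrow> 'y bword) \<Rightarrow> 'y bword \<Rightarrow> 'y bword" where
  "subst \<sigma> w = concat (map (subst_letter \<sigma>) w)"

text \<open>The symbols of a set \<open>X\<close> together with three new ones; \<open>X\<close> is identified with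
  \<open>Gen ` X\<close>.\<close>

datatype 'a symb = Gen 'a | Star | Star1 | Star2

definition words :: "'a set \<Rightarrow> 'a symb bword set" where
  "words X = bracketed_words (Gen ` X)"

definition star_words :: "'a set \<Rightarrow> 'a symb bword set" where
  "star_words X = {q \<in> bracketed_words (Gen ` X \<union> {Star}). occ Star q = 1}"

definition star12_words :: "'a set \<Rightarrow> 'a symb bword set" where
  "star12_words X =
     {q \<in> bracketed_words (Gen ` X \<union> {Star1, Star2}). occ Star1 q = 1 \<and> occ Star2 q = 1}"

text \<open>\<open>plug q s\<close> is \<open>q|\<^sub>s\<close>, and \<open>plug2 q s1 s2\<close> is the two-place version.\<close>

definition plug :: "'a symb bword \<Rightarrow> 'a symb bword \<Rightarrow> 'a symb bword" where
  "plug q s = subst ((\<lambda>y. [Sym y])(Star := s)) q"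

definition plug2 :: "'a symb bword \<Rightarrow> 'a symb bword \<Rightarrow> 'a symb bword \<Rightarrow> 'a symb bword" where
  "plug2 q s1 s2 = subst ((\<lambda>y. [Sym y])(Star1 := s1, Star2 := s2)) q"

type_synonym 'a located = "'a symb bword \<times> 'a symb bword"

definition placement :: "'a set \<Rightarrow> 'a symb bword \<Rightarrow> 'a located \<Rightarrow> bool" where
  "placement X f = (\<lambda>(s, q). s \<in> words X \<and> s \<noteq> [] \<and> q \<in> star_words X \<and> f = plug q s)"

definition separated :: "'a set \<Rightarrow> 'a symb bword \<Rightarrow> 'a located \<Rightarrow> 'a located \<Rightarrow> bool" where
  "separated X f = (\<lambda>(s1, q1) (s2, q2).
     \<exists>q \<in> star12_words X.
       plug q1 [Sym Star1] = plug2 q [Sym Star1] s2 \<and>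
       plug q2 [Sym Star2] = plug2 q s1 [Sym Star2] \<and>
       f = plug2 q s1 s2)"

definition nested :: "'a set \<Rightarrow> 'a located \<Rightarrow> 'a located \<Rightarrow> bool" where
  "nested X = (\<lambda>(s1, q1) (s2, q2).
     \<exists>q \<in> star_words X. q1 = plug q2 q \<or> q2 = plug q1 q)"

definition intersecting :: "'a set \<Rightarrow> 'a symb bword \<Rightarrow> 'a located \<Rightarrow> 'a located \<Rightarrow> bool" where
  "intersecting X f = (\<lambda>(s1, q1) (s2, q2).
     \<exists>q \<in> star_words X. \<exists>a \<in> words X - {[]}. \<exists>b \<in> words X - {[]}. \<exists>c \<in> words X - {[]}.
       (f = plug q (a @ b @ c) \<and> q1 = plug q (Sym Star # c) \<and> q2 = plug q (a @ [Sym Star])) \<or>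
       (f = plug q (a @ b @ c) \<and> q1 = plug q (a @ [Sym Star]) \<and> q2 = plug q (Sym Star # c)))"

end

theory Submission imports Defs begin

text \<open>Writing a bracketed word as the preorder sequence of its symbols and brackets, a placement
  becomes an interval: the offset of the hole together with the number of tokens of the subword.
  Separated placements give disjoint intervals, nested ones an inclusion, and intersecting ones
  an overlap without inclusion; since the subwords are nonempty, at most one of the relations holds.
  That at least one holds is an induction on the contexts: as long as both holes lie in the same
  bracket one descends into it, and otherwise the two positions are compared in one flat list.\<close>

section \<open>Token sequences and induction on bracketed words\<close>

text \<open>\<open>None\<close> marks a bracket. No closing marker is needed: the offsets below only use that
  tokenization is additive and that nonempty words have tokens.\<close>

primrec tokens_letter :: "'y letter \<Rightarrow> 'y option list" where
  "tokens_letter (Sym y) = [Some y]"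
| "tokens_letter (Bracket w) = None # concat (map tokens_letter w)"

definition tokens :: "'y bword \<Rightarrow> 'y option list" where
  "tokens w = concat (map tokens_letter w)"

lemma tokens_simps [simp]:
  "tokens [] = []"
  "tokens (Sym y # w) = Some y # tokens w"
  "tokens (Bracket v # w) = None # tokens v @ tokens w"
  "tokens (v @ w) = tokens v @ tokens w"
  by (simp_all add: tokens_def)

lemma tokens_eq_Nil [simp]: "tokens w = [] \<longleftrightarrow> w = []"
proof (cases w)
  case (Cons l v)
  then show ?thesis by (cases l) auto
qed simp

text \<open>The content of a bracket and the tail behind it both have fewer tokens than the whole
  word, so one predicate on words suffices and no separate one on letters arises.\<close>

lemma bword_induct [case_names Nil Sym Bracket]:
  assumes "P []"
    and "\<And>y w. P w \<Longrightarrow> P (Sym y # w)"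
    and "\<And>v w. P v \<Longrightarrow> P w \<Longrightarrow> P (Bracket v # w)"
  shows "P w"
proof (induction "length (tokens w)" arbitrary: w rule: less_induct)
  case less
  show ?case
  proof (cases w)
    case (Cons l v)
    then show ?thesis using less assms by (cases l) auto
  qed (simp add: assms)
qed

section \<open>Substitution and occurrence counts\<close>

lemma subst_simps [simp]:
  "subst \<sigma> [] = []"
  "subst \<sigma> (Sym y # w) = \<sigma> y @ subst \<sigma> w"
  "subst \<sigma> (Bracket v # w) = Bracket (subst \<sigma> v) # subst \<sigma> w"
  "subst \<sigma> (v @ w) = subst \<sigma> v @ subst \<sigma> w"
  by (simp_all add: subst_def)

lemma occ_simps [simp]:
  "occ y [] = 0"
  "occ y (Sym z # w) = (if z = y then 1 else 0) + occ y w"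
  "occ y (Bracket v # w) = occ y v + occ y w"
  "occ y (v @ w) = occ y v + occ y w"
  by (simp_all add: occ_def)

text \<open>Together with \<open>subst_cong\<close>, this reduces the identities between iterated
  pluggings to comparisons on single symbols.\<close>

lemma subst_subst: "subst \<sigma> (subst \<tau> w) = subst (\<lambda>y. subst \<sigma> (\<tau> y)) w"
  by (induction w rule: bword_induct) auto

lemma subst_ident: "(\<And>y. Some y \<in> set (tokens w) \<Longrightarrow> \<sigma> y = [Sym y]) \<Longrightarrow> subst \<sigma> w = w"
  by (induction w rule: bword_induct) auto

lemma subst_cong:
  "(\<And>y. Some y \<in> set (tokens w) \<Longrightarrow> \<sigma> y = \<tau> y) \<Longrightarrow> subst \<sigma> w = subst \<tau> w"
  by (induction w rule: bword_induct) auto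

lemma tokens_subst:
  "tokens (subst \<sigma> w) =
     concat (map (\<lambda>t. case t of None \<Rightarrow> [None] | Some y \<Rightarrow> tokens (\<sigma> y)) (tokens w))"
  by (induction w rule: bword_induct) auto

lemma occ_conv_tokens: "occ y w = count_list (tokens w) (Some y)"
  by (induction w rule: bword_induct) auto

section \<open>Word sets described by their symbols\<close>

lemma bracketed_stage_Suc: "bracketed_stage n Y \<subseteq> bracketed_stage (Suc n) Y"
proof (induction n)
  case 0
  show ?case by (auto simp: lists_eq_set)
next
  case (Suc n)
  then have "Sym ` Y \<union> Bracket ` bracketed_stage n Y
      \<subseteq> Sym ` Y \<union> Bracket ` bracketed_stage (Suc n) Y"
    by blast
  then show ?case
    unfolding bracketed_stage.simps(2) by (rule lists_mono)
qed

lemma bracketed_stage_mono: "m \<le> n \<Longrightarrow> bracketed_stage m Y \<subseteq> bracketed_stage n Y"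
  by (rule lift_Suc_mono_le[of "\<lambda>n. bracketed_stage n Y", OF bracketed_stage_Suc])

lemma bracketed_stage_tokens:
  "w \<in> bracketed_stage n Y \<Longrightarrow> Some y \<in> set (tokens w) \<Longrightarrow> y \<in> Y"
proof (induction n arbitrary: w)
  case 0
  then show ?case by (induction w rule: bword_induct) auto
next
  case (Suc n)
  have "Some y \<in> set (tokens w) \<Longrightarrow> y \<in> Y" if "w \<in> lists (Sym ` Y \<union> Bracket ` bracketed_stage n Y)" for w
    using that
  proof (induction w)
    case (Cons l w)
    then show ?case using Suc.IH by (cases l) auto
  qed simp
  then show ?case using Suc.prems by simp
qed

text \<open>A word is finite, so its bracket depth is bounded and some stage admits it; only the
  condition on its symbols remains.\<close>

lemma bracketed_words_iff:
  "w \<in> bracketed_words Y \<longleftrightarrow> (\<forall>y. Some y \<in> set (tokens w) \<longrightarrow> y \<in> Y)"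
proof
  assume "w \<in> bracketed_words Y"
  then show "\<forall>y. Some y \<in> set (tokens w) \<longrightarrow> y \<in> Y"
    by (auto simp: bracketed_words_def dest: bracketed_stage_tokens)
next
  assume "\<forall>y. Some y \<in> set (tokens w) \<longrightarrow> y \<in> Y"
  then have "\<exists>n. w \<in> bracketed_stage (Suc n) Y"
  proof (induction w rule: bword_induct)
    case (Bracket v w)
    then obtain m n where "v \<in> bracketed_stage (Suc m) Y" "w \<in> bracketed_stage (Suc n) Y"
      by auto
    \<comment> \<open>\<open>k\<close> bounds both stages, so \<open>Bracket v\<close> is a letter
      available at stage \<open>Suc k\<close>, where \<open>w\<close> lies as well.\<close>
    moreover define k where "k = Suc (max m n)"
    ultimately have v: "v \<in> bracketed_stage k Y" and w: "w \<in> bracketed_stage (Suc k) Y"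
      using bracketed_stage_mono[of "Suc m" k Y] bracketed_stage_mono[of "Suc n" "Suc k" Y]
      unfolding k_def by (blast intro: le_SucI max.cobounded1 max.cobounded2 Suc_le_mono[THEN iffD2])+
    from v have "Bracket v \<in> Sym ` Y \<union> Bracket ` bracketed_stage k Y" by blast
    with w have "Bracket v # w \<in> bracketed_stage (Suc k) Y" by simp
    then show ?case ..
  qed auto
  then show "w \<in> bracketed_words Y" unfolding bracketed_words_def by blast
qed

lemma words_iff: "w \<in> words X \<longleftrightarrow> (\<forall>y. Some y \<in> set (tokens w) \<longrightarrow> y \<in> Gen ` X)"
  by (simp add: words_def bracketed_words_iff)

lemma words_simps [simp]:
  "[] \<in> words X"
  "Sym y # w \<in> words X \<longleftrightarrow> y \<in> Gen ` X \<and> w \<in> words X"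
  "Bracket v # w \<in> words X \<longleftrightarrow> v \<in> words X \<and> w \<in> words X"
  "v @ w \<in> words X \<longleftrightarrow> v \<in> words X \<and> w \<in> words X"
  by (auto simp: words_iff)

lemma words_tokens:
  assumes "w \<in> words X" "y \<in> {Star, Star1, Star2}"
  shows "Some y \<notin> set (tokens w)"
  using assms by (auto simp: words_iff)

lemma occ_words:
  assumes "w \<in> words X" "y \<in> {Star, Star1, Star2}"
  shows "occ y w = 0"
  using words_tokens[OF assms] by (simp add: occ_conv_tokens)

section \<open>Plugging, and contexts with one or two holes\<close>

lemma plug_simps [simp]:
  "plug [] s = []"
  "plug (Sym y # w) s = (if y = Star then s else [Sym y]) @ plug w s"
  "plug (Bracket v # w) s = Bracket (plug v s) # plug w s"
  "plug (v @ w) s = plug v s @ plug w s"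
  by (simp_all add: plug_def)

lemma plug2_simps [simp]:
  "plug2 [] s t = []"
  "plug2 (Sym y # w) s t = (if y = Star1 then s else if y = Star2 then t else [Sym y]) @ plug2 w s t"
  "plug2 (Bracket v # w) s t = Bracket (plug2 v s t) # plug2 w s t"
  "plug2 (v @ w) s t = plug2 v s t @ plug2 w s t"
  by (simp_all add: plug2_def)

lemma plug_words [simp]: "w \<in> words X \<Longrightarrow> plug w s = w"
  unfolding plug_def by (rule subst_ident) (auto simp: words_iff)

lemma plug2_words [simp]: "w \<in> words X \<Longrightarrow> plug2 w s t = w"
  unfolding plug2_def by (rule subst_ident) (auto simp: words_iff)

lemma star_words_iff:
  "q \<in> star_words X \<longleftrightarrow>
     (\<forall>y. Some y \<in> set (tokens q) \<longrightarrow> y \<in> insert Star (Gen ` X)) \<and> occ Star q = 1"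
  by (auto simp: star_words_def bracketed_words_iff)

lemma star12_words_iff:
  "q \<in> star12_words X \<longleftrightarrow>
     (\<forall>y. Some y \<in> set (tokens q) \<longrightarrow> y \<in> insert Star1 (insert Star2 (Gen ` X))) \<and>
     occ Star1 q = 1 \<and> occ Star2 q = 1"
  by (auto simp: star12_words_def bracketed_words_iff)

lemma star_words_hole [simp]:
  "u \<in> words X \<Longrightarrow> v \<in> words X \<Longrightarrow> u @ Sym Star # v \<in> star_words X"
  by (auto simp: star_words_iff words_iff occ_words)

lemma star_words_layer [simp]:
  "u \<in> words X \<Longrightarrow> v \<in> words X \<Longrightarrow> q \<in> star_words X \<Longrightarrow> u @ Bracket q # v \<in> star_words X"
  by (auto simp: star_words_iff words_iff occ_words)

lemma star12_words_layer [simp]: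
  "u \<in> words X \<Longrightarrow> v \<in> words X \<Longrightarrow> q \<in> star12_words X \<Longrightarrow> u @ Bracket q # v \<in> star12_words X"
  by (auto simp: star12_words_iff words_iff occ_words)

lemma star12_words_holes [simp]:
  "u \<in> words X \<Longrightarrow> e \<in> words X \<Longrightarrow> v \<in> words X \<Longrightarrow>
    u @ Sym Star1 # e @ Sym Star2 # v \<in> star12_words X"
  by (auto simp: star12_words_iff words_iff occ_words)

text \<open>\<open>Star\<close> occurs once, so exactly one letter of the list carries it, and this
  letter is the hole or a bracket around a smaller context.\<close>

lemma star_words_split:
  assumes "q \<in> star_words X"
  obtains u v where "q = u @ Sym Star # v" "u \<in> words X" "v \<in> words X"
  | u r v where "q = u @ Bracket r # v" "u \<in> words X" "v \<in> words X" "r \<in> star_words X"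
proof -
  \<comment> \<open>Absence of \<open>Star\<close> brings the enlarged alphabet back to that of
    \<open>words X\<close>.\<close>
  have *: "w \<in> words X" if "\<forall>y. Some y \<in> set (tokens w) \<longrightarrow> y \<in> insert Star (Gen ` X)" "occ Star w = 0"
    for w
    using that by (auto simp: words_iff occ_conv_tokens count_list_0_iff)
  have "(\<exists>u v. q = u @ Sym Star # v \<and> u \<in> words X \<and> v \<in> words X) \<or>
        (\<exists>u r v. q = u @ Bracket r # v \<and> u \<in> words X \<and> v \<in> words X \<and> r \<in> star_words X)"
    using assms
  proof (induction q)
    case Nil
    then show ?case by (simp add: star_words_iff)
  next
    case (Cons l w)
    show ?case
    \<comment> \<open>The first letter is tested for the hole by counting in the one-letter word
      \<open>[l]\<close>.\<close>
    proof (cases "occ Star [l] = 0")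
      case True
      then have l: "[l] \<in> words X"
        using Cons.prems by (intro *) (cases l; auto simp: star_words_iff)+
      have "w \<in> star_words X"
        using Cons.prems True by (cases l) (auto simp: star_words_iff)
      then consider u v where "w = u @ Sym Star # v" "u \<in> words X" "v \<in> words X"
        | u r v where "w = u @ Bracket r # v" "u \<in> words X" "v \<in> words X" "r \<in> star_words X"
        using Cons.IH by blast
      then show ?thesis
      proof cases
        case 1
        then have "l # w = ([l] @ u) @ Sym Star # v" "[l] @ u \<in> words X"
          using l by (simp_all only: words_simps) simp_all
        then show ?thesis using 1 by blast
      next
        case 2
        then have "l # w = ([l] @ u) @ Bracket r # v" "[l] @ u \<in> words X"
          using l by (simp_all only: words_simps) simp_all
        then show ?thesis using 2 by blast
      qed
    next
      case False
      then have "occ Star w = 0" using Cons.prems by (cases l) (auto simp: star_words_iff split: if_splits)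
      moreover from this have w: "w \<in> words X"
        using Cons.prems by (intro *) (cases l; auto simp: star_words_iff)+
      show ?thesis
      proof (cases l)
        case (Sym y)
        then have "l # w = [] @ Sym Star # w" using False by (auto split: if_splits)
        then show ?thesis using w words_simps(1) by blast
      next
        case (Bracket r)
        then have "r \<in> star_words X"
          using Cons.prems \<open>occ Star w = 0\<close> by (auto simp: star_words_iff)
        moreover have "l # w = [] @ Bracket r # w" using Bracket by simp
        ultimately show ?thesis using w words_simps(1) by blast
      qed
    qed
  qed
  then show thesis using that by blast
qed

text \<open>Iterating the split follows the hole inwards; the context \<open>r\<close> below a
  bracket has fewer tokens, so the descent ends.\<close>

lemma star_words_induct [consumes 1, case_names hole layer]:
  assumes "q \<in> star_words X"
    and "\<And>u v. u \<in> words X \<Longrightarrow> v \<in> words X \<Longrightarrow> P (u @ Sym Star # v)"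
    and "\<And>u r v. u \<in> words X \<Longrightarrow> v \<in> words X \<Longrightarrow> r \<in> star_words X \<Longrightarrow> P r \<Longrightarrow> P (u @ Bracket r # v)"
  shows "P q"
  using assms(1)
proof (induction "length (tokens q)" arbitrary: q rule: less_induct)
  case less
  from less.prems show ?case
  proof (cases rule: star_words_split)
    case (1 u v)
    then show ?thesis using assms(2) by simp
  next
    case (2 u r v)
    then show ?thesis using less.hyps[of r] assms(3) by simp
  qed
qed

section \<open>Symmetric form of separation\<close>

text \<open>A context with its hole renamed can be part of a two-hole context; the other marker does
  not occur in it, so filling that marker has no effect here.\<close>

lemma plug2_plug_Star1:
  assumes "q \<in> star_words X"
  shows "plug2 (plug q [Sym Star1]) s t = plug q s"
  unfolding plug2_def plug_def subst_subst
  by (rule subst_cong) (use assms in \<open>auto simp: star_words_iff\<close>)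

lemma plug2_plug_Star2:
  assumes "q \<in> star_words X"
  shows "plug2 (plug q [Sym Star2]) s t = plug q t"
  unfolding plug2_def plug_def subst_subst
  by (rule subst_cong) (use assms in \<open>auto simp: star_words_iff\<close>)

lemma plug_Star: "plug q [Sym Star] = q"
  unfolding plug_def by (rule subst_ident) auto

text \<open>\<open>Q\<close> has no \<open>Star\<close> of its own, so \<open>r\<close> only reaches
  the inserted words.\<close>

lemma plug_plug2:
  assumes "Q \<in> star12_words X"
  shows "plug (plug2 Q s t) r = plug2 Q (plug s r) (plug t r)"
  unfolding plug2_def plug_def subst_subst
  by (rule subst_cong) (use assms in \<open>auto simp: star12_words_iff\<close>)

text \<open>The relation \<^const>\<open>separated\<close> with both markers renamed to \<^const>\<open>Star\<close>, which makes it
  symmetric; the equation for \<open>f\<close> is then automatic.\<close>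

definition disjoint_holes :: "'a set \<Rightarrow> 'a located \<Rightarrow> 'a located \<Rightarrow> bool" where
  "disjoint_holes X = (\<lambda>(s1, q1) (s2, q2).
     \<exists>Q \<in> star12_words X. q1 = plug2 Q [Sym Star] s2 \<and> q2 = plug2 Q s1 [Sym Star])"

lemma disjoint_holesI:
  "Q \<in> star12_words X \<Longrightarrow> q1 = plug2 Q [Sym Star] s2 \<Longrightarrow> q2 = plug2 Q s1 [Sym Star] \<Longrightarrow>
    disjoint_holes X (s1, q1) (s2, q2)"
  by (auto simp: disjoint_holes_def)

text \<open>Exchanging the two markers in the witness exchanges the roles of the placements.\<close>

lemma disjoint_holes_sym:
  assumes "disjoint_holes X (s1, q1) (s2, q2)"
  shows "disjoint_holes X (s2, q2) (s1, q1)"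
proof -
  from assms obtain Q where Q: "Q \<in> star12_words X"
    "q1 = plug2 Q [Sym Star] s2" "q2 = plug2 Q s1 [Sym Star]"
    by (auto simp: disjoint_holes_def)
  \<comment> \<open>Substitution is simultaneous, so this exchanges the markers instead of merging
    them.\<close>
  let ?Q = "plug2 Q [Sym Star2] [Sym Star1]"
  have swap: "plug2 ?Q s t = plug2 Q t s" for s t
    unfolding plug2_def subst_subst
    by (rule subst_cong) (use Q(1) in \<open>auto simp: star12_words_iff\<close>)
  have occ: "occ Star1 (plug2 w [Sym Star2] [Sym Star1]) = occ Star2 w"
    "occ Star2 (plug2 w [Sym Star2] [Sym Star1]) = occ Star1 w" for w :: "'a symb bword"
    by (induction w rule: bword_induct) auto
  have "?Q \<in> star12_words X"
    using Q(1) unfolding star12_words_iff occ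
    by (auto simp: plug2_def tokens_subst split: option.splits if_splits)
  then show ?thesis
    unfolding disjoint_holes_def Q(2,3) by (auto simp: swap intro!: bexI[of _ ?Q])
qed

text \<open>Plugging \<open>Star1\<close>, \<open>Star2\<close> or \<open>s1\<close> for
  \<open>Star\<close> yields the three equations, since \<open>s1\<close> and \<open>s2\<close>
  contain no \<open>Star\<close> and stay unchanged.\<close>

lemma disjoint_holes_separated:
  assumes "disjoint_holes X (s1, q1) (s2, q2)" "s1 \<in> words X" "s2 \<in> words X"
  shows "separated X (plug q1 s1) (s1, q1) (s2, q2)"
proof -
  from assms(1) obtain Q where Q: "Q \<in> star12_words X"
    "q1 = plug2 Q [Sym Star] s2" "q2 = plug2 Q s1 [Sym Star]"
    by (auto simp: disjoint_holes_def)
  then have "plug q1 [Sym Star1] = plug2 Q [Sym Star1] s2" "plug q2 [Sym Star2] = plug2 Q s1 [Sym Star2]"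
    "plug q1 s1 = plug2 Q s1 s2"
    using assms(2,3) by (simp_all add: plug_plug2)
  then show ?thesis
    using Q(1) by (auto simp: separated_def)
qed

lemma nested_sym: "nested X p1 p2 \<Longrightarrow> nested X p2 p1"
  by (cases p1; cases p2) (auto simp: nested_def)

lemma intersecting_sym: "intersecting X f p1 p2 \<Longrightarrow> intersecting X f p2 p1"
  by (cases p1; cases p2) (fastforce simp: intersecting_def)

section \<open>Existence: at least one relation holds\<close>

text \<open>Both holes lie in the top-level list, so two factors of one list are compared. The first
  factor starts no later than the second; the other order follows by symmetry.\<close>

lemma top_top_trichotomy:
  assumes "u1 @ s1 @ v1 = u2 @ s2 @ v2" "length u1 \<le> length u2"
    and w: "u1 \<in> words X" "s1 \<in> words X" "v1 \<in> words X" "u2 \<in> words X" "s2 \<in> words X" "v2 \<in> words X"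
  defines "q1 \<equiv> u1 @ Sym Star # v1" and "q2 \<equiv> u2 @ Sym Star # v2"
  shows "disjoint_holes X (s1, q1) (s2, q2) \<or> nested X (s1, q1) (s2, q2)
    \<or> intersecting X (plug q1 s1) (s1, q1) (s2, q2)"
proof -
  have "u2 = u1 @ drop (length u1) u2"
    using assms(1,2) by (metis append_eq_append_conv_if append_take_drop_id)
  \<comment> \<open>\<open>d\<close> is the stretch from the start of the first factor to the start
    of the second.\<close>
  with assms(1) obtain d where d: "u2 = u1 @ d" "s1 @ v1 = d @ s2 @ v2"
    by (metis append_assoc same_append_eq)
  from d(2) consider e where "d = s1 @ e" "v1 = e @ s2 @ v2"
    | e where "s1 = d @ e" "e @ v1 = s2 @ v2"
    unfolding append_eq_append_conv2[of s1] by metis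
  then show ?thesis
  proof cases
    case 1
    let ?Q = "u1 @ Sym Star1 # e @ Sym Star2 # v2"
    have "e \<in> words X" using 1 w by simp
    then have "?Q \<in> star12_words X" "q1 = plug2 ?Q [Sym Star] s2" "q2 = plug2 ?Q s1 [Sym Star]"
      using 1 w d(1) by (simp_all add: q1_def q2_def)
    then show ?thesis by (blast intro: disjoint_holesI)
  next
    case 2
    \<comment> \<open>\<open>e\<close> is the part of \<open>s1\<close> from the start of
      \<open>s2\<close> onwards: either \<open>s2\<close> ends within it, or \<open>s2\<close>
      extends to its end or beyond.\<close>
    from 2(2) consider g where "e = s2 @ g" "v2 = g @ v1" | g where "s2 = e @ g" "v1 = g @ v2"
      unfolding append_eq_append_conv2[of e] by metis
    then show ?thesis
    proof cases
      case 1
      let ?q = "d @ Sym Star # g"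
      have "?q \<in> star_words X" "q2 = plug q1 ?q"
        using 1 2 w d(1) by (simp_all add: q1_def q2_def)
      then show ?thesis by (auto simp: nested_def)
    next
      case g: 2
      show ?thesis
      \<comment> \<open>\<open>s1 = d @ e\<close> and \<open>s2 = e @ g\<close> share
        \<open>e\<close>. An empty \<open>d\<close> makes \<open>s1\<close> a prefix of
        \<open>s2\<close>, an empty \<open>g\<close> makes \<open>s2\<close> a suffix of
        \<open>s1\<close>, and an empty \<open>e\<close> makes them adjacent and hence
        disjoint.\<close>
      proof (cases "d = [] \<or> g = [] \<or> e = []")
        case True
        then consider "d = []" | "g = []" | "e = []" by blast
        then show ?thesis
        proof cases
          case 1
          have "[] @ Sym Star # g \<in> star_words X" "q1 = plug q2 ([] @ Sym Star # g)"
            using star_words_hole[of "[]" X g] 1 2 g w d(1) by (simp_all add: q1_def q2_def)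
          then show ?thesis by (auto simp: nested_def)
        next
          case 2
          have "d @ Sym Star # [] \<in> star_words X" "q2 = plug q1 (d @ Sym Star # [])"
            using 2 \<open>s1 = d @ e\<close> g w d(1) by (simp_all add: q1_def q2_def)
          then show ?thesis by (auto simp: nested_def)
        next
          case 3
          let ?Q = "u1 @ Sym Star1 # [] @ Sym Star2 # v2"
          have "?Q \<in> star12_words X"
            using w by (intro star12_words_holes) simp_all
          moreover have "q1 = plug2 ?Q [Sym Star] s2" "q2 = plug2 ?Q s1 [Sym Star]"
            using 3 2 g w d(1) by (simp_all add: q1_def q2_def)
          ultimately show ?thesis by (blast intro: disjoint_holesI)
        qed
      next
        case False
        \<comment> \<open>The hole of \<open>?q\<close> covers the union \<open>d @ e @ g\<close> of
          the two factors.\<close>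
        let ?q = "u1 @ Sym Star # v2"
        have "?q \<in> star_words X" "d \<in> words X - {[]}" "e \<in> words X - {[]}" "g \<in> words X - {[]}"
          "plug q1 s1 = plug ?q (d @ e @ g)" "q1 = plug ?q (Sym Star # g)" "q2 = plug ?q (d @ [Sym Star])"
          using False 2 g w d(1) by (simp_all add: q1_def q2_def)
        then show ?thesis unfolding intersecting_def by blast
      qed
    qed
  qed
qed

text \<open>Serves to check that contexts with renamed holes are admissible below the brackets of a
  two-hole context.\<close>

lemma plug_mark:
  assumes "r \<in> star_words X" "z \<in> {Star1, Star2}"
  shows tokens_plug_mark: "Some y \<in> set (tokens (plug r [Sym z])) \<Longrightarrow> y = z \<or> y \<in> Gen ` X"
    and occ_plug_mark: "y \<in> {Star1, Star2} \<Longrightarrow> occ y (plug r [Sym z]) = (if y = z then 1 else 0)"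
proof -
  have tok: "y = z \<or> y \<in> Gen ` X" if "Some y \<in> set (tokens (plug r [Sym z]))" for y
    using that assms by (auto simp: star_words_iff plug_def tokens_subst split: option.splits if_splits)
  then show "Some y \<in> set (tokens (plug r [Sym z])) \<Longrightarrow> y = z \<or> y \<in> Gen ` X" .
  \<comment> \<open>Each hole turns into one \<open>z\<close> and the \<open>z\<close> already
    present stay, because \<open>z\<close> differs from \<open>Star\<close>.\<close>
  have "occ z (plug w [Sym z]) = occ z w + occ Star w" for w
    using assms(2) by (induction w rule: bword_induct) auto
  moreover have "occ z r = 0"
    using assms by (auto simp: star_words_iff occ_conv_tokens count_list_0_iff)
  ultimately have "occ z (plug r [Sym z]) = 1"
    using assms(1) by (simp add: star_words_iff)
  moreover have "occ y (plug r [Sym z]) = 0" if "y \<noteq> z" "y \<in> {Star1, Star2}"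
    using that tok[of y] by (auto simp: occ_conv_tokens count_list_0_iff)
  ultimately show "y \<in> {Star1, Star2} \<Longrightarrow> occ y (plug r [Sym z]) = (if y = z then 1 else 0)"
    by simp
qed

lemma star12_words_plug_layer:
  assumes "u \<in> words X" "e \<in> words X" "v \<in> words X" "r \<in> star_words X"
  shows "u @ Bracket (plug r [Sym Star1]) # e @ Sym Star2 # v \<in> star12_words X"
    and "u @ Sym Star1 # e @ Bracket (plug r [Sym Star2]) # v \<in> star12_words X"
    and "r' \<in> star_words X \<Longrightarrow>
      u @ Bracket (plug r [Sym Star1]) # e @ Bracket (plug r' [Sym Star2]) # v \<in> star12_words X"
  using assms tokens_plug_mark[of r X Star1] tokens_plug_mark[of r X Star2]
    tokens_plug_mark[of r' X Star2]
  by (auto simp: star12_words_iff words_iff occ_words occ_plug_mark)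

text \<open>The bracket holding the second hole is one letter of the list, which a factor contains
  or avoids but cannot cut; hence no intersection arises.\<close>

lemma top_layer_trichotomy:
  assumes eq: "u1 @ s1 @ v1 = u2 @ Bracket (plug r s2) # v2"
    and w: "u1 \<in> words X" "s1 \<in> words X" "v1 \<in> words X" "u2 \<in> words X" "v2 \<in> words X"
    and r: "r \<in> star_words X"
  defines "q1 \<equiv> u1 @ Sym Star # v1" and "q2 \<equiv> u2 @ Bracket r # v2"
  shows "disjoint_holes X (s1, q1) (s2, q2) \<or> nested X (s1, q1) (s2, q2)"
proof -
  have "(\<exists>e. u1 = u2 @ Bracket (plug r s2) # e \<and> v2 = e @ s1 @ v1)
    \<or> (\<exists>d e. u2 = u1 @ d \<and> s1 = d @ Bracket (plug r s2) # e \<and> v2 = e @ v1)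
    \<or> (\<exists>e. u2 = u1 @ s1 @ e \<and> v1 = e @ Bracket (plug r s2) # v2)"
    using eq by (auto simp: append_eq_append_conv2 append_eq_Cons_conv Cons_eq_append_conv)
  then consider (before) e where "u1 = u2 @ Bracket (plug r s2) # e" "v2 = e @ s1 @ v1"
    | (inside) d e where "u2 = u1 @ d" "s1 = d @ Bracket (plug r s2) # e" "v2 = e @ v1"
    | (after) e where "u2 = u1 @ s1 @ e" "v1 = e @ Bracket (plug r s2) # v2"
    by blast
  then show ?thesis
  proof cases
    case before
    \<comment> \<open>The markers follow the order in the list, so \<open>Star1\<close> belongs to
      the second placement and the relation is obtained for the swapped pair.\<close>
    let ?Q = "u2 @ Bracket (plug r [Sym Star1]) # e @ Sym Star2 # v1"
    have "e \<in> words X" using before w by simp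
    then have "?Q \<in> star12_words X" "q2 = plug2 ?Q [Sym Star] s1" "q1 = plug2 ?Q s2 [Sym Star]"
      using before w r by (simp_all add: star12_words_plug_layer plug2_plug_Star1 plug_Star q1_def q2_def)
    then have "disjoint_holes X (s2, q2) (s1, q1)" by (blast intro: disjoint_holesI)
    then show ?thesis by (blast intro: disjoint_holes_sym)
  next
    case inside
    \<comment> \<open>\<open>?q\<close> is \<open>s1\<close> with the hole of \<open>r\<close>
      reopened inside its bracket.\<close>
    let ?q = "d @ Bracket r # e"
    have "?q \<in> star_words X" "q2 = plug q1 ?q"
      using inside w r by (simp_all add: q1_def q2_def)
    then show ?thesis by (auto simp: nested_def)
  next
    case after
    let ?Q = "u1 @ Sym Star1 # e @ Bracket (plug r [Sym Star2]) # v2"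
    have "e \<in> words X" using after w by simp
    then have "?Q \<in> star12_words X" "q1 = plug2 ?Q [Sym Star] s2" "q2 = plug2 ?Q s1 [Sym Star]"
      using after w r by (simp_all add: star12_words_plug_layer plug2_plug_Star2 plug_Star q1_def q2_def)
    then show ?thesis by (blast intro: disjoint_holesI)
  qed
qed

text \<open>Each hole lies below its own letter, so the two contexts can be marked
  independently.\<close>

lemma distinct_layers_disjoint:
  assumes "u2 = u1 @ Bracket (plug r1 s1) # e" "v1 = e @ Bracket (plug r2 s2) # v2"
    and w: "u1 \<in> words X" "v1 \<in> words X" "u2 \<in> words X" "v2 \<in> words X"
    and r: "r1 \<in> star_words X" "r2 \<in> star_words X"
  shows "disjoint_holes X (s1, u1 @ Bracket r1 # v1) (s2, u2 @ Bracket r2 # v2)"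
proof -
  let ?Q = "u1 @ Bracket (plug r1 [Sym Star1]) # e @ Bracket (plug r2 [Sym Star2]) # v2"
  have "e \<in> words X" using assms by simp
  then have "?Q \<in> star12_words X" "u1 @ Bracket r1 # v1 = plug2 ?Q [Sym Star] s2"
    "u2 @ Bracket r2 # v2 = plug2 ?Q s1 [Sym Star]"
    using assms by (simp_all add: star12_words_plug_layer plug2_plug_Star1 plug2_plug_Star2 plug_Star)
  then show ?thesis by (blast intro: disjoint_holesI)
qed

text \<open>The descent into a common bracket: a witness for disjoint holes or intersection gets
  wrapped in that bracket, and one for nesting is kept as it is.\<close>

lemma layer_trichotomy:
  assumes w: "u \<in> words X" "v \<in> words X"
    and rel: "disjoint_holes X (s1, r1) (s2, r2) \<or> nested X (s1, r1) (s2, r2)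
      \<or> intersecting X (plug r1 s1) (s1, r1) (s2, r2)"
  defines "q1 \<equiv> u @ Bracket r1 # v" and "q2 \<equiv> u @ Bracket r2 # v"
  shows "disjoint_holes X (s1, q1) (s2, q2) \<or> nested X (s1, q1) (s2, q2)
    \<or> intersecting X (plug q1 s1) (s1, q1) (s2, q2)"
proof -
  consider "disjoint_holes X (s1, r1) (s2, r2)" | "nested X (s1, r1) (s2, r2)"
    | "intersecting X (plug r1 s1) (s1, r1) (s2, r2)"
    using rel by blast
  then show ?thesis
  proof cases
    case 1
    then obtain Q where "Q \<in> star12_words X" "r1 = plug2 Q [Sym Star] s2" "r2 = plug2 Q s1 [Sym Star]"
      by (auto simp: disjoint_holes_def)
    then have "u @ Bracket Q # v \<in> star12_words X" "q1 = plug2 (u @ Bracket Q # v) [Sym Star] s2"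
      "q2 = plug2 (u @ Bracket Q # v) s1 [Sym Star]"
      using w by (simp_all add: q1_def q2_def)
    then show ?thesis by (blast intro: disjoint_holesI)
  next
    case 2
    then show ?thesis using w by (auto simp: nested_def q1_def q2_def)
  next
    case 3
    then obtain q a b c where *: "q \<in> star_words X" "a \<in> words X - {[]}" "b \<in> words X - {[]}" "c \<in> words X - {[]}"
      "plug r1 s1 = plug q (a @ b @ c)"
      "r1 = plug q (Sym Star # c) \<and> r2 = plug q (a @ [Sym Star]) \<or>
       r1 = plug q (a @ [Sym Star]) \<and> r2 = plug q (Sym Star # c)"
      unfolding intersecting_def by blast
    let ?q = "u @ Bracket q # v"
    have "?q \<in> star_words X" "plug q1 s1 = plug ?q (a @ b @ c)"
      "q1 = plug ?q (Sym Star # c) \<and> q2 = plug ?q (a @ [Sym Star]) \<or>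
       q1 = plug ?q (a @ [Sym Star]) \<and> q2 = plug ?q (Sym Star # c)"
      using * w by (auto simp: q1_def q2_def)
    then show ?thesis unfolding intersecting_def using *(2-4) by blast
  qed
qed

text \<open>The induction keeps \<open>q2\<close> arbitrary because descending into a common bracket
  shrinks both contexts.\<close>

lemma placements_related:
  assumes "q1 \<in> star_words X" "q2 \<in> star_words X" "s1 \<in> words X" "s2 \<in> words X"
    and "plug q1 s1 = plug q2 s2"
  shows "disjoint_holes X (s1, q1) (s2, q2) \<or> nested X (s1, q1) (s2, q2)
    \<or> intersecting X (plug q1 s1) (s1, q1) (s2, q2)"
  using assms
proof (induction q1 arbitrary: q2 rule: star_words_induct)
  case (hole u1 v1)
  note w = hole.hyps \<open>s1 \<in> words X\<close> \<open>s2 \<in> words X\<close>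
  from \<open>q2 \<in> star_words X\<close> show ?case
  proof (cases rule: star_words_split)
    case (1 u2 v2)
    then have eq: "u1 @ s1 @ v1 = u2 @ s2 @ v2" using hole by simp
    show ?thesis
    proof (cases "length u1 \<le> length u2")
      case True
      show ?thesis using top_top_trichotomy[OF eq True] w 1 by simp
    next
      case False
      \<comment> \<open>With the placements exchanged, the intersection refers to the filling of the
        second context, so it is transported along this equality.\<close>
      have f: "plug (u1 @ Sym Star # v1) s1 = plug (u2 @ Sym Star # v2) s2" using hole 1 by blast
      have "length u2 \<le> length u1" using False by simp
      from top_top_trichotomy[OF eq[symmetric] this] show ?thesis
        unfolding 1(1) f using w 1 by (blast intro: disjoint_holes_sym nested_sym intersecting_sym)
    qed
  next
    case (2 u2 r v2)
    then have "u1 @ s1 @ v1 = u2 @ Bracket (plug r s2) # v2" using hole by simp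
    from top_layer_trichotomy[OF this w(1,3,2) 2(2,3,4)] show ?thesis unfolding 2(1) by blast
  qed
next
  case (layer u1 r1 v1)
  note w = layer.hyps \<open>s1 \<in> words X\<close> \<open>s2 \<in> words X\<close>
  from \<open>q2 \<in> star_words X\<close> show ?case
  proof (cases rule: star_words_split)
    case (1 u2 v2)
    then have "u2 @ s2 @ v2 = u1 @ Bracket (plug r1 s1) # v1" using layer by simp
    from top_layer_trichotomy[OF this 1(2) w(5) 1(3) w(1,2,3)] show ?thesis
      unfolding 1(1) by (blast intro: disjoint_holes_sym nested_sym)
  next
    case (2 u2 r2 v2)
    then have "u1 @ Bracket (plug r1 s1) # v1 = u2 @ Bracket (plug r2 s2) # v2" using layer by simp
    \<comment> \<open>Both brackets are letters of one list: they are the same letter, or the second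
      lies to the right or to the left of the first.\<close>
    then have "u1 = u2 \<and> v1 = v2 \<and> plug r1 s1 = plug r2 s2
      \<or> (\<exists>e. u2 = u1 @ Bracket (plug r1 s1) # e \<and> v1 = e @ Bracket (plug r2 s2) # v2)
      \<or> (\<exists>e. u1 = u2 @ Bracket (plug r2 s2) # e \<and> v2 = e @ Bracket (plug r1 s1) # v1)"
      by (auto simp: append_eq_append_conv2 append_eq_Cons_conv Cons_eq_append_conv)
    then consider (same) "u1 = u2" "v1 = v2" "plug r1 s1 = plug r2 s2"
      | (right) e where "u2 = u1 @ Bracket (plug r1 s1) # e" "v1 = e @ Bracket (plug r2 s2) # v2"
      | (left) e where "u1 = u2 @ Bracket (plug r2 s2) # e" "v2 = e @ Bracket (plug r1 s1) # v1"
      by blast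
    then show ?thesis
    proof cases
      case same
      have "disjoint_holes X (s1, r1) (s2, r2) \<or> nested X (s1, r1) (s2, r2)
          \<or> intersecting X (plug r1 s1) (s1, r1) (s2, r2)"
        using layer.IH[OF 2(4) w(4,5) same(3)] .
      from layer_trichotomy[OF w(1,2) this] show ?thesis
        unfolding 2(1) same(1,2)[symmetric] .
    next
      case right
      show ?thesis
        unfolding 2(1) using distinct_layers_disjoint[OF right w(1,2) 2(2,3) w(3) 2(4)] ..
    next
      case left
      show ?thesis
        unfolding 2(1)
        using disjoint_holes_sym[OF distinct_layers_disjoint[OF left 2(2,3) w(1,2) 2(4) w(3)]] ..
    qed
  qed
qed

section \<open>Exclusion: offsets and intervals of tokens\<close>

text \<open>If \<open>Star\<close> does not occur, the value is the number of all tokens.\<close>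

definition offset :: "'a symb bword \<Rightarrow> nat" where
  "offset q = length (takeWhile (\<lambda>t. t \<noteq> Some Star) (tokens q))"

lemma takeWhile_no_Star:
  "Some Star \<notin> set ts \<Longrightarrow>
    takeWhile (\<lambda>t. t \<noteq> Some Star) (ts @ us) = ts @ takeWhile (\<lambda>t. t \<noteq> Some Star) us"
  by (induction ts) auto

lemma tokens_star_words:
  assumes "q \<in> star_words X"
  obtains ts us where "tokens q = ts @ Some Star # us" "length ts = offset q"
    "\<And>y. Some y \<in> set (ts @ us) \<Longrightarrow> y \<in> Gen ` X"
proof -
  have "Some Star \<in> set (tokens q)"
    using assms by (auto simp: star_words_iff occ_conv_tokens intro: ccontr)
  then obtain ts us where ts: "tokens q = ts @ Some Star # us" "Some Star \<notin> set ts"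
    by (meson split_list_first)
  then have "Some Star \<notin> set us"
    using assms by (auto simp: star_words_iff occ_conv_tokens count_list_0_iff)
  then have "y \<in> Gen ` X" if "Some y \<in> set (ts @ us)" for y
    using that ts assms by (auto simp: star_words_iff)
  moreover have "length ts = offset q"
    using ts by (simp add: offset_def takeWhile_no_Star)
  ultimately show thesis
    using that ts(1) by blast
qed

abbreviation subst_tokens :: "('y \<Rightarrow> 'y bword) \<Rightarrow> 'y option list \<Rightarrow> 'y option list" where
  "subst_tokens \<sigma> ts \<equiv> concat (map (\<lambda>t. case t of None \<Rightarrow> [None] | Some y \<Rightarrow> tokens (\<sigma> y)) ts)"

lemma subst_tokens_ident:
  "(\<And>y. Some y \<in> set ts \<Longrightarrow> \<sigma> y = [Sym y]) \<Longrightarrow> subst_tokens \<sigma> ts = ts"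
  by (induction ts) (auto split: option.splits)

text \<open>The parts \<open>ts\<close> and \<open>us\<close> do not depend on \<open>s\<close>, so
  filling the hole replaces one token by a block starting at the offset; this block is the interval
  of a placement.\<close>

lemma tokens_plug:
  assumes "q \<in> star_words X"
  obtains ts us where "length ts = offset q" "tokens q = ts @ Some Star # us"
    "\<And>s. tokens (plug q s) = ts @ tokens s @ us" "Some Star \<notin> set ts"
proof -
  obtain ts us where *: "tokens q = ts @ Some Star # us" "length ts = offset q"
    "\<And>y. Some y \<in> set (ts @ us) \<Longrightarrow> y \<in> Gen ` X"
    using tokens_star_words[OF assms] by blast
  have "subst_tokens ((\<lambda>y. [Sym y])(Star := s)) ts = ts" "subst_tokens ((\<lambda>y. [Sym y])(Star := s)) us = us" for s
    by (rule subst_tokens_ident; use *(3) in force)+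
  then show thesis
    using that[of ts us] * by (force simp: plug_def tokens_subst)
qed

text \<open>The hole itself is a token that disappears, whence the \<open>Suc\<close>.\<close>

lemma length_tokens_plug:
  assumes "q \<in> star_words X"
  shows "Suc (length (tokens (plug q s))) = length (tokens q) + length (tokens s)"
  by (rule tokens_plug[OF assms]) simp

lemma offset_less: "q \<in> star_words X \<Longrightarrow> offset q < length (tokens q)"
  by (rule tokens_plug) auto

text \<open>The first \<open>Star\<close> of the result is that of \<open>r\<close>; without one in
  \<open>r\<close> the count would run on into the rest of \<open>q\<close>.\<close>

lemma offset_plug:
  assumes "q \<in> star_words X" "Some Star \<in> set (tokens r)"
  shows "offset (plug q r) = offset q + offset r"
proof -
  obtain ts us where "length ts = offset q" "tokens (plug q r) = ts @ tokens r @ us" "Some Star \<notin> set ts"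
    using tokens_plug[OF assms(1)] by metis
  then show ?thesis
    using assms(2) by (simp add: takeWhile_no_Star takeWhile_append1 offset_def[of r] offset_def[of "plug q r"])
qed

lemma offset_append:
  assumes "a \<in> words X"
  shows "offset (a @ Sym Star # c) = length (tokens a)"
  using words_tokens[OF assms, of Star] by (simp add: offset_def takeWhile_no_Star)

lemma nested_offset:
  assumes "nested X (s1, q1) (s2, q2)" "q1 \<in> star_words X" "q2 \<in> star_words X" "plug q1 s1 = plug q2 s2"
  shows "offset q2 \<le> offset q1 \<and> offset q1 + length (tokens s1) \<le> offset q2 + length (tokens s2)
    \<or> offset q1 \<le> offset q2 \<and> offset q2 + length (tokens s2) \<le> offset q1 + length (tokens s1)"
proof -
  \<comment> \<open>One inclusion is proved for generic contexts; both orientations of nesting are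
    instances.\<close>
  have *: "offset p2 \<le> offset p1 \<and> offset p1 + length (tokens t1) \<le> offset p2 + length (tokens t2)"
    if "p1 = plug p2 q" "q \<in> star_words X" "p1 \<in> star_words X" "p2 \<in> star_words X" "plug p1 t1 = plug p2 t2"
    for p1 p2 t1 t2 q
  proof -
    have "Some Star \<in> set (tokens q)" using that(2) by (rule tokens_star_words) simp
    then have "offset p1 = offset p2 + offset q" using that(1,4) offset_plug by blast
    \<comment> \<open>The two fillings of the same word give \<open>length (tokens t2) = length
      (tokens t1) + length (tokens q) - 1\<close>, and at least one token of \<open>q\<close> is its
      hole.\<close>
    moreover note length_tokens_plug[OF that(4), of q] length_tokens_plug[OF that(4), of t2]
      length_tokens_plug[OF that(3), of t1] offset_less[OF that(2)]
    ultimately show ?thesis using that(1,5) by simp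
  qed
  from assms(1) show ?thesis using *[of q1 q2 _ s1 s2] *[of q2 q1 _ s2 s1] assms(2-) by (auto simp: nested_def)
qed

text \<open>Inside the hole of \<open>q\<close>, one interval covers \<open>a @ b\<close> and the
  other \<open>b @ c\<close>; nonempty \<open>a\<close>, \<open>b\<close> and \<open>c\<close> make
  the three inequalities strict.\<close>

lemma intersecting_offset:
  assumes "intersecting X (plug q1 s1) (s1, q1) (s2, q2)" "q1 \<in> star_words X" "q2 \<in> star_words X"
    "plug q1 s1 = plug q2 s2"
  shows "offset q1 < offset q2 \<and> offset q2 < offset q1 + length (tokens s1)
      \<and> offset q1 + length (tokens s1) < offset q2 + length (tokens s2)
    \<or> offset q2 < offset q1 \<and> offset q1 < offset q2 + length (tokens s2)
      \<and> offset q2 + length (tokens s2) < offset q1 + length (tokens s1)"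
proof -
  have *: "offset p1 < offset p2 \<and> offset p2 < offset p1 + length (tokens t1)
      \<and> offset p1 + length (tokens t1) < offset p2 + length (tokens t2)"
    if "q \<in> star_words X" "a \<in> words X - {[]}" "b \<in> words X - {[]}" "c \<in> words X - {[]}"
      "plug p1 t1 = plug q (a @ b @ c)" "p1 = plug q (Sym Star # c)" "p2 = plug q (a @ [Sym Star])"
      "p1 \<in> star_words X" "p2 \<in> star_words X" "plug p1 t1 = plug p2 t2" for q a b c p1 p2 t1 t2
  proof -
    have "offset p1 = offset q" "offset p2 = offset q + length (tokens a)"
      using that(1,2,6,7) offset_plug[of q X] offset_append[of "[]" X] offset_append[of a X] by force+
    moreover have "length (tokens t1) = length (tokens a) + length (tokens b)"
      using length_tokens_plug[OF that(1), of "a @ b @ c"] length_tokens_plug[OF that(8), of t1]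
        length_tokens_plug[OF that(1), of "Sym Star # c"] that(5,6)
      by simp
    moreover have "length (tokens t2) = length (tokens b) + length (tokens c)"
      using length_tokens_plug[OF that(1), of "a @ b @ c"] length_tokens_plug[OF that(9), of t2]
        length_tokens_plug[OF that(1), of "a @ [Sym Star]"] that(5,7,10)
      by simp
    ultimately show ?thesis using that(2-4) by simp
  qed
  from assms(1) obtain q a b c where q: "q \<in> star_words X" "a \<in> words X - {[]}" "b \<in> words X - {[]}"
    "c \<in> words X - {[]}" "plug q1 s1 = plug q (a @ b @ c)"
    and "q1 = plug q (Sym Star # c) \<and> q2 = plug q (a @ [Sym Star])
      \<or> q1 = plug q (a @ [Sym Star]) \<and> q2 = plug q (Sym Star # c)"
    unfolding intersecting_def by blast
  then consider "q1 = plug q (Sym Star # c)" "q2 = plug q (a @ [Sym Star])"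
    | "q2 = plug q (Sym Star # c)" "q1 = plug q (a @ [Sym Star])" by blast
  then show ?thesis
  proof cases
    case 1
    from *[OF q 1 assms(2-4)] show ?thesis ..
  next
    case 2
    \<comment> \<open>In the other orientation the common word is first rewritten as the filling of
      \<open>q2\<close>.\<close>
    from *[OF q(1-4) q(5)[unfolded assms(4)] 2 assms(3,2) assms(4)[symmetric]] show ?thesis ..
  qed
qed

text \<open>Setting both markers to \<open>Star\<close> in the defining equations removes the
  different names; \<open>s1\<close> and \<open>s2\<close> contain no marker and are
  unaffected.\<close>

lemma separated_disjoint_holes:
  assumes "separated X f (s1, q1) (s2, q2)" "q1 \<in> star_words X" "q2 \<in> star_words X"
    "s1 \<in> words X" "s2 \<in> words X"
  shows "disjoint_holes X (s1, q1) (s2, q2)"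
proof -
  from assms(1) obtain Q where Q: "Q \<in> star12_words X" "plug q1 [Sym Star1] = plug2 Q [Sym Star1] s2"
    "plug q2 [Sym Star2] = plug2 Q s1 [Sym Star2]"
    by (auto simp: separated_def)
  have "plug2 (plug2 Q a b) s t = plug2 Q (plug2 a s t) (plug2 b s t)" for a b s t
    unfolding plug2_def subst_subst
    by (rule subst_cong) (use Q(1) in \<open>auto simp: star12_words_iff\<close>)
  then have "q1 = plug2 Q [Sym Star] s2" "q2 = plug2 Q s1 [Sym Star]"
    using arg_cong[OF Q(2), of "\<lambda>w. plug2 w [Sym Star] [Sym Star]"]
      arg_cong[OF Q(3), of "\<lambda>w. plug2 w [Sym Star] [Sym Star]"] assms(2-)
    by (simp_all add: plug2_plug_Star1 plug2_plug_Star2 plug_Star)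
  then show ?thesis using Q(1) by (auto simp: disjoint_holes_def)
qed

text \<open>Whichever marker comes first in \<open>Q\<close>, its filling precedes the other hole
  entirely.\<close>

lemma disjoint_holes_offset:
  assumes "disjoint_holes X (s1, q1) (s2, q2)" "s1 \<in> words X" "s2 \<in> words X"
  shows "offset q1 + length (tokens s1) \<le> offset q2 \<or> offset q2 + length (tokens s2) \<le> offset q1"
proof -
  from assms(1) obtain Q where Q: "Q \<in> star12_words X" "q1 = plug2 Q [Sym Star] s2" "q2 = plug2 Q s1 [Sym Star]"
    by (auto simp: disjoint_holes_def)
  have count: "count_list (tokens Q) (Some Star1) = 1" "count_list (tokens Q) (Some Star2) = 1"
    and gen: "\<And>y. Some y \<in> set (tokens Q) \<Longrightarrow> y \<in> {Star1, Star2} \<union> Gen ` X"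
    using Q(1) by (auto simp: star12_words_iff occ_conv_tokens)
  have "Some Star1 \<in> set (tokens Q)" using count by (auto intro: ccontr)
  then obtain as bs where ab: "tokens Q = as @ Some Star1 # bs" by (meson split_list)
  have "Some Star2 \<in> set as \<or> Some Star2 \<in> set bs" using count ab by (auto intro: ccontr)
  \<comment> \<open>\<open>y\<close> and \<open>z\<close> name the two markers in order of
    occurrence, so both orders are treated at once.\<close>
  then obtain ts us vs y z where Q': "tokens Q = ts @ Some y # us @ Some z # vs" "y = Star1 \<and> z = Star2 \<or> y = Star2 \<and> z = Star1"
    using ab split_list by (metis append.assoc append_Cons)
  then have "Some Star1 \<notin> set (ts @ us)" "Some Star2 \<notin> set (ts @ us)"
    using count by (auto simp: count_list_0_iff)
  with gen Q' have gen': "y \<in> Gen ` X" if "Some y \<in> set (ts @ us)" for y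
    using that by (metis (no_types, lifting) Un_iff append_assoc empty_iff insert_iff set_append list.set_intros(2))
  then have star: "Some Star \<notin> set (ts @ us)" by blast
  have ident: "subst_tokens ((\<lambda>y. [Sym y])(Star1 := s, Star2 := t)) ts = ts"
    "subst_tokens ((\<lambda>y. [Sym y])(Star1 := s, Star2 := t)) us = us"
    for s t
    by (rule subst_tokens_ident; use gen' in force)+
  have "Some Star \<notin> set (tokens s1)" "Some Star \<notin> set (tokens s2)"
    using assms(2,3) by (auto dest: words_tokens)
  \<comment> \<open>The hole at \<open>y\<close> has offset \<open>length ts\<close>; the other one
    comes after \<open>ts\<close>, the tokens filled in for \<open>y\<close>, and
    \<open>us\<close>.\<close>
  then show ?thesis
    using Q'(2) star
    by (auto simp: offset_def Q(2,3) plug2_def tokens_subst Q'(1) ident takeWhile_no_Star)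
qed

theorem theorem4p11:
  fixes X :: "'a set" and f s1 q1 s2 q2 :: "'a symb bword"
  assumes "f \<in> words X"
    and "placement X f (s1, q1)"
    and "placement X f (s2, q2)"
  shows "(separated X f (s1, q1) (s2, q2) \<and> \<not> nested X (s1, q1) (s2, q2)
            \<and> \<not> intersecting X f (s1, q1) (s2, q2))
       \<or> (\<not> separated X f (s1, q1) (s2, q2) \<and> nested X (s1, q1) (s2, q2)
            \<and> \<not> intersecting X f (s1, q1) (s2, q2))
       \<or> (\<not> separated X f (s1, q1) (s2, q2) \<and> \<not> nested X (s1, q1) (s2, q2)
            \<and> intersecting X f (s1, q1) (s2, q2))"
proof -
  have p: "q1 \<in> star_words X" "q2 \<in> star_words X" "s1 \<in> words X" "s2 \<in> words X"
    "f = plug q1 s1" "plug q1 s1 = plug q2 s2" "s1 \<noteq> []" "s2 \<noteq> []"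
    using assms(2,3) by (auto simp: placement_def)
  \<comment> \<open>An empty interval could be disjoint from another and included in it at once;
    positive lengths exclude this.\<close>
  have len: "length (tokens s1) > 0" "length (tokens s2) > 0"
    using p by auto
  note nst = nested_offset[OF _ p(1,2,6)] and int = intersecting_offset[OF _ p(1,2,6), folded p(5)]
  have sep: "separated X f (s1, q1) (s2, q2) \<Longrightarrow>
      offset q1 + length (tokens s1) \<le> offset q2 \<or> offset q2 + length (tokens s2) \<le> offset q1"
    using disjoint_holes_offset separated_disjoint_holes p by blast
  have "separated X f (s1, q1) (s2, q2) \<or> nested X (s1, q1) (s2, q2) \<or> intersecting X f (s1, q1) (s2, q2)"
    using placements_related[OF p(1-4,6)] disjoint_holes_separated p by blast
  moreover have False if "separated X f (s1, q1) (s2, q2)" "nested X (s1, q1) (s2, q2)"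
    using sep[OF that(1)] nst[OF that(2)] len by linarith
  \<comment> \<open>An overlap is strict at both ends, which contradicts disjointness here and
    inclusion in the next case.\<close>
  moreover have False if "separated X f (s1, q1) (s2, q2)" "intersecting X f (s1, q1) (s2, q2)"
    using sep[OF that(1)] int[OF that(2)] by linarith
  moreover have False if "nested X (s1, q1) (s2, q2)" "intersecting X f (s1, q1) (s2, q2)"
    using nst[OF that(1)] int[OF that(2)] by linarith
  ultimately show ?thesis by blast
qed

end
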